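(* Let $n\ge 1$ and let $M\in M_{n,n}(K)$ with $\mathrm{rank}(M)\ge n-1$. Let $\det{}'(M) : M_{n,n}(K)\to K$ be the differential of the determinant at $M$, that is, $dM\mapsto \mathrm{Tr}(\mathrm{Com}(M)\cdot dM)$, and let $\mathcal{L}_0 = M_{n,n}(\mathcal{O}_K)$. Setting $v = \sigma_1(M)+\cdots+\sigma_{n-1}(M)$, we have $$\det{}'(M)(\mathcal{L}_0) = \pi^v\mathcal{O}_K.$$
   Context: $K$ is a complete discrete valuation field with valuation $\mathrm{val} : K \to \mathbb{Z}\cup\{+\infty\}$ (surjective), ring of integers $\mathcal{O}_K$ and $\pi\in K$ an element of valuation $1$. Smith decomposition: a matrix $M\in M_{n,n}(K)$ can be written $M = U_M\cdot\Delta_M\cdot V_M$ with $U_M, V_M\in GL_n(\mathcal{O}_K)$ and $\Delta_M$ diagonal. $\sigma_i(M)$ denotes the valuation of the $(i,i)$-th entry of $\Delta_M$ ($+\infty$ if the entry is $0$), ordered so that $\sigma_i(M)\le\sigma_{i+1}(M)$. $\mathrm{Com}(M)$ denotes the comatrix of $M$, normalized so that $\mathrm{Com}(M)=\det(M)M^{-1}$ when $M$ is invertible (i.e. the adjugate matrix). *)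

theory Defs
  imports
    "HOL-Library.Extended"
    "Jordan_Normal_Form.Determinant"
    "Jordan_Normal_Form.DL_Rank"
begin

text \<open>
  Valuations take values in \<^typ>\<open>int extended\<close>, with \<^const>\<open>Pinf\<close> as the value at zero. The point
  \<^const>\<open>Minf\<close> of that type is excluded by the assumption on the range.
\<close>

locale complete_discrete_valuation_field =
  fixes val :: "'a::field \<Rightarrow> int extended"
  assumes range_val: "range val = range Fin \<union> {Pinf}"
    and val_eq_Pinf_iff: "val x = Pinf \<longleftrightarrow> x = 0"
    and val_mult: "val (x * y) = val x + val y"
    and val_add: "min (val x) (val y) \<le> val (x + y)"
    and val_complete:
      "(\<forall>N::int. \<exists>k::nat. \<forall>i\<ge>k. \<forall>j\<ge>k. Fin N \<le> val (s i - s j)) \<Longrightarrow>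
        \<exists>l. \<forall>N::int. \<exists>k::nat. \<forall>i\<ge>k. Fin N \<le> val (s i - l)"

definition integer_ring :: "('a::field \<Rightarrow> int extended) \<Rightarrow> 'a set" where
  "integer_ring val = {x. 0 \<le> val x}"

definition integral_mats :: "('a::field \<Rightarrow> int extended) \<Rightarrow> nat \<Rightarrow> 'a mat set" where
  "integral_mats val n =
    {A \<in> carrier_mat n n. \<forall>i<n. \<forall>j<n. A $$ (i, j) \<in> integer_ring val}"

definition integral_GL :: "('a::field \<Rightarrow> int extended) \<Rightarrow> nat \<Rightarrow> 'a mat set" where
  "integral_GL val n =
    {U \<in> integral_mats val n. \<exists>W \<in> integral_mats val n. U * W = 1\<^sub>m n \<and> W * U = 1\<^sub>m n}"

definition is_smith_decomposition ::
    "('a::field \<Rightarrow> int extended) \<Rightarrow> 'a mat \<Rightarrow> 'a mat \<times> 'a mat \<times> 'a mat \<Rightarrow> bool" where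
  "is_smith_decomposition val M = (\<lambda>(U, D, V). let n = dim_row M in
    U \<in> integral_GL val n \<and> V \<in> integral_GL val n \<and>
    D \<in> carrier_mat n n \<and> diagonal_mat D \<and>
    (\<forall>i. Suc i < n \<longrightarrow> val (D $$ (i, i)) \<le> val (D $$ (Suc i, Suc i))) \<and>
    M = U * D * V)"

definition smith_decomposition ::
    "('a::field \<Rightarrow> int extended) \<Rightarrow> 'a mat \<Rightarrow> 'a mat \<times> 'a mat \<times> 'a mat" where
  "smith_decomposition val M = (SOME T. is_smith_decomposition val M T)"

text \<open>The index of \<open>sigma\<close> starts at 1, whereas matrix entries are indexed from 0.\<close>

definition sigma :: "('a::field \<Rightarrow> int extended) \<Rightarrow> 'a mat \<Rightarrow> nat \<Rightarrow> int extended" where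
  "sigma val M i = (case smith_decomposition val M of (U, D, V) \<Rightarrow> val (D $$ (i - 1, i - 1)))"

definition mat_trace :: "'a::comm_monoid_add mat \<Rightarrow> 'a" where
  "mat_trace A = (\<Sum>i<dim_row A. A $$ (i, i))"

text \<open>
  The comatrix in the normalization \<open>Com M = det M \<cdot> M\<^sup>-\<^sup>1\<close> is the adjugate \<^const>\<open>adj_mat\<close>
  (the transposed matrix of cofactors).
\<close>

definition det_differential :: "'a::field mat \<Rightarrow> 'a mat \<Rightarrow> 'a" where
  "det_differential M dM = mat_trace (adj_mat M * dM)"

end

theory Submission
  imports Defs "Jordan_Normal_Form.Char_Poly"
begin

text \<open>
  The adjugate is anti-multiplicative, so for a Smith decomposition \<open>M = U D V\<close> cyclicity of the trace
  turns \<open>Tr (Com M \<cdot> X)\<close> into \<open>Tr (Com D \<cdot> (Com U \<cdot> X \<cdot> Com V))\<close>. Since \<open>Com U\<close> and \<open>Com V\<close> are again in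
  \<open>GL\<^sub>n(O)\<close>, one may replace \<open>M\<close> by \<open>D\<close>. The rank condition makes the first \<open>n - 1\<close> diagonal entries
  of \<open>D\<close> nonzero, and by the ordering of the valuations every entry of \<open>Com D\<close> is an integral multiple of the last
  diagonal one, which is the product of those \<open>n - 1\<close> entries.
\<close>

section \<open>The adjugate\<close>

text \<open>Cofactors are polynomial expressions in the entries, so ring homomorphisms commute with
  the adjugate. It is applied to evaluation of polynomials at 0.\<close>

lemma (in comm_ring_hom) adj_mat_hom:
  assumes "A \<in> carrier_mat n n"
  shows "adj_mat (map_mat hom A) = map_mat hom (adj_mat A)"
proof -
  have "mat_delete (map_mat hom A) i j = map_mat hom (mat_delete A i j)" if "i < n" "j < n" for i j
    using that assms by (intro eq_matI) (auto simp: mat_delete_def)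
  then show ?thesis
    using assms by (intro eq_matI) (auto simp: adj_mat_def cofactor_def hom_distribs)
qed

lemma smult_smult_mat: "a \<cdot>\<^sub>m (b \<cdot>\<^sub>m A) = (a * b) \<cdot>\<^sub>m (A :: 'a::semigroup_mult mat)"
  by (intro eq_matI) (auto simp: mult.assoc)

lemma smult_mat_cancel:
  fixes A B :: "'a::idom mat"
  assumes eq: "k \<cdot>\<^sub>m A = k \<cdot>\<^sub>m B" and "k \<noteq> 0"
  shows "A = B"
proof (rule eq_matI)
  show dim: "dim_row A = dim_row B" "dim_col A = dim_col B"
    using arg_cong[OF eq, of dim_row] arg_cong[OF eq, of dim_col] by simp_all
  show "A $$ (i, j) = B $$ (i, j)" if "i < dim_row B" "j < dim_col B" for i j
    using arg_cong[OF eq, of "\<lambda>X. X $$ (i, j)"] that dim \<open>k \<noteq> 0\<close> by simp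
qed

text \<open>Simplify \<open>adj_mat B * adj_mat A * (A * B * adj_mat (A * B))\<close> in two ways:
  from the left the adjugates cancel against \<open>A\<close> and \<open>B\<close>, from the right
  \<open>A * B\<close> cancels against its own adjugate. Both give the scalar
  \<open>det A * det B\<close>, which can be cancelled in a domain. The setting of domains covers
  polynomial matrices.\<close>

lemma adj_mat_mult_of_det_nonzero:
  fixes A B :: "'a::idom mat"
  assumes A: "A \<in> carrier_mat n n" and B: "B \<in> carrier_mat n n"
    and det: "det A \<noteq> 0" "det B \<noteq> 0"
  shows "adj_mat (A * B) = adj_mat B * adj_mat A"
proof -
  note adjA = adj_mat[OF A] and adjB = adj_mat[OF B]
  have AB: "A * B \<in> carrier_mat n n" using A B by simp
  note adjAB = adj_mat[OF AB]
  have smult: "X * (k \<cdot>\<^sub>m Y) = k \<cdot>\<^sub>m (X * Y)" "(k \<cdot>\<^sub>m X) * Y = k \<cdot>\<^sub>m (X * Y)"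
    if "X \<in> carrier_mat n n" "Y \<in> carrier_mat n n" for k and X Y :: "'a mat"
    using that by (auto intro: mult_smult_distrib mult_smult_assoc_mat)
  have "adj_mat B * adj_mat A * (A * B * adj_mat (A * B))
      = adj_mat B * (adj_mat A * A) * B * adj_mat (A * B)"
    using A B adjA(1) adjB(1) adjAB(1) by (simp add: assoc_mult_mat[of _ n n _ n _ n])
  also have "\<dots> = det A \<cdot>\<^sub>m (adj_mat B * B * adj_mat (A * B))"
    using A B adjA(1) adjB(1) adjAB(1) by (simp add: adjA(3) smult)
  also have "\<dots> = (det A * det B) \<cdot>\<^sub>m adj_mat (A * B)"
    using adjAB(1) by (simp add: adjB(3) smult smult_smult_mat)
  finally have "(det A * det B) \<cdot>\<^sub>m adj_mat (A * B)
      = (det A * det B) \<cdot>\<^sub>m (adj_mat B * adj_mat A)"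
    using adjA(1) adjB(1) by (simp add: adjAB(2) smult det_mult[OF A B])
  then show ?thesis by (rule smult_mat_cancel) (simp add: det)
qed

text \<open>Passing to \<open>A + t\<close> and \<open>B + t\<close>, whose determinants are monic in \<open>t\<close>, removes the
  hypothesis on the determinants.\<close>

lemma adj_mat_mult:
  fixes A B :: "'a::field mat"
  assumes A: "A \<in> carrier_mat n n" and B: "B \<in> carrier_mat n n"
  shows "adj_mat (A * B) = adj_mat B * adj_mat A"
proof -
  \<comment> \<open>\<open>char_poly_matrix Y\<close> is \<open>t - Y\<close>, so the sign makes
    \<open>lift X\<close> equal to \<open>t + X\<close>, which specializes to \<open>X\<close> at
    \<open>t = 0\<close>.\<close>
  define lift :: "'a mat \<Rightarrow> 'a poly mat" where "lift X = char_poly_matrix (- X)" for X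
  have carrier: "lift X \<in> carrier_mat n n" if "X \<in> carrier_mat n n" for X
    using that by (simp add: lift_def)
  have det: "det (lift X) \<noteq> 0" if "X \<in> carrier_mat n n" for X
    using degree_monic_char_poly[of "- X" n] that
    by (auto simp: lift_def char_poly_def)
  have eval: "map_mat (\<lambda>p. poly p 0) (lift X) = X" if "X \<in> carrier_mat n n" for X
    using that by (intro eq_matI) (auto simp: lift_def char_poly_matrix_def)
  have eval_mult: "map_mat (\<lambda>p. poly p 0) (X * Y) = map_mat (\<lambda>p. poly p 0) X * map_mat (\<lambda>p. poly p 0) Y"
    if "X \<in> carrier_mat n n" "Y \<in> carrier_mat n n" for X Y :: "'a poly mat"
    using that by (rule semiring_hom.mat_hom_mult[OF poly_hom.semiring_hom_axioms])
  have eval_adj: "map_mat (\<lambda>p. poly p 0) (adj_mat X) = adj_mat (map_mat (\<lambda>p. poly p 0) X)"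
    if "X \<in> carrier_mat n n" for X :: "'a poly mat"
    using comm_ring_hom.adj_mat_hom[OF poly_hom.comm_ring_hom_axioms that] by (rule sym)
  note lift = carrier[OF A] carrier[OF B]
  have "adj_mat (A * B) = map_mat (\<lambda>p. poly p 0) (adj_mat (lift A * lift B))"
    using lift by (simp add: eval A B eval_mult eval_adj)
  also have "\<dots> = map_mat (\<lambda>p. poly p 0) (adj_mat (lift B) * adj_mat (lift A))"
    by (simp add: adj_mat_mult_of_det_nonzero[OF lift det[OF A] det[OF B]])
  also have "\<dots> = adj_mat B * adj_mat A"
    using lift by (simp add: eval A B eval_mult eval_adj adj_mat(1))
  finally show ?thesis .
qed

lemma adj_mat_one: "adj_mat (1\<^sub>m n :: 'a::comm_ring_1 mat) = 1\<^sub>m n"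
proof -
  have "1 \<cdot>\<^sub>m 1\<^sub>m n = (1\<^sub>m n :: 'a mat)" by (intro eq_matI) auto
  then show ?thesis using adj_mat(1,2)[of "1\<^sub>m n :: 'a mat" n] by simp
qed

section \<open>Traces and the differential of the determinant under change of basis\<close>

lemma mat_trace_mult_commute:
  fixes A B :: "'a::comm_semiring_0 mat"
  assumes "A \<in> carrier_mat n m" "B \<in> carrier_mat m n"
  shows "mat_trace (A * B) = mat_trace (B * A)"
proof -
  have "mat_trace (A * B) = (\<Sum>i<n. \<Sum>j<m. A $$ (i, j) * B $$ (j, i))"
    using assms by (auto simp: mat_trace_def scalar_prod_def atLeast0LessThan)
  also have "\<dots> = (\<Sum>j<m. \<Sum>i<n. B $$ (j, i) * A $$ (i, j))"
    by (subst sum.swap) (simp add: mult.commute)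
  also have "\<dots> = mat_trace (B * A)"
    using assms by (auto simp: mat_trace_def scalar_prod_def atLeast0LessThan)
  finally show ?thesis .
qed

text \<open>The adjugate of the product is \<open>adj_mat V * adj_mat D * adj_mat U\<close>, and
  cyclicity of the trace carries \<open>adj_mat V\<close> to the right end. \<open>D\<close> may be
  singular, as it is when \<open>M\<close> has rank \<open>n - 1\<close>.\<close>

lemma det_differential_mult:
  fixes U D V X :: "'a::field mat"
  assumes U: "U \<in> carrier_mat n n" and D: "D \<in> carrier_mat n n" and V: "V \<in> carrier_mat n n"
    and X: "X \<in> carrier_mat n n"
  shows "det_differential (U * D * V) X = det_differential D (adj_mat U * X * adj_mat V)"
proof -
  note adj = adj_mat(1)[OF U] adj_mat(1)[OF D] adj_mat(1)[OF V]
  have "adj_mat (U * D * V) * X = adj_mat V * (adj_mat D * adj_mat U * X)"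
    using U D V X adj by (simp add: adj_mat_mult[of _ n] assoc_mult_mat[of _ n n _ n _ n])
  moreover have "mat_trace \<dots> = mat_trace (adj_mat D * adj_mat U * X * adj_mat V)"
    using X adj by (intro mat_trace_mult_commute[of _ n n]) auto
  ultimately show ?thesis
    using X adj by (simp add: det_differential_def assoc_mult_mat[of _ n n _ n _ n])
qed

section \<open>Rank\<close>

text \<open>The matrix is a sum of \<open>r\<close> outer products, each of rank at most 1, and rank
  is subadditive.\<close>

lemma (in vec_space) rank_sum_products_le:
  assumes "A \<in> carrier_mat n nc"
    and "\<And>i j. i < n \<Longrightarrow> j < nc \<Longrightarrow> A $$ (i, j) = (\<Sum>k<r. f k i * g k j)"
  shows "rank A \<le> r"
  using assms
proof (induction r arbitrary: A)
  case 0
  then have "A = 0\<^sub>m n nc" by (intro eq_matI) auto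
  then show ?case by (simp add: rank_0I)
next
  case (Suc r)
  define B where "B = mat n nc (\<lambda>(i, j). \<Sum>k<r. f k i * g k j)"
  define C where "C = mat n nc (\<lambda>(i, j). f r i * g r j)"
  have "A = B + C" using Suc.prems by (intro eq_matI) (auto simp: B_def C_def)
  moreover have "rank B \<le> r" by (rule Suc.IH) (auto simp: B_def)
  moreover have "rank C \<le> 1"
    by (rule rank_le_1_product_entries[of _ nc "f r" "g r"]) (auto simp: C_def)
  ultimately show ?case using rank_subadditive[of B nc C] by (simp add: B_def C_def)
qed

lemma index_mult_diagonal_mat:
  fixes A D :: "'a::semiring_1 mat"
  assumes "A \<in> carrier_mat m n" "D \<in> carrier_mat n n" "diagonal_mat D" "i < m" "j < n"
  shows "(A * D) $$ (i, j) = A $$ (i, j) * D $$ (j, j)"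
proof -
  have "(A * D) $$ (i, j) = (\<Sum>k<n. A $$ (i, k) * D $$ (k, j))"
    using assms by (auto simp: scalar_prod_def atLeast0LessThan)
  also have "\<dots> = (\<Sum>k<n. if k = j then A $$ (i, j) * D $$ (j, j) else 0)"
    using assms by (intro sum.cong) (auto simp: diagonal_mat_def)
  finally show ?thesis using assms by simp
qed

lemma index_diagonal_mat_mult:
  fixes A D :: "'a::semiring_1 mat"
  assumes "D \<in> carrier_mat m m" "A \<in> carrier_mat m n" "diagonal_mat D" "i < m" "j < n"
  shows "(D * A) $$ (i, j) = D $$ (i, i) * A $$ (i, j)"
proof -
  have "(D * A) $$ (i, j) = (\<Sum>k<m. D $$ (i, k) * A $$ (k, j))"
    using assms by (auto simp: scalar_prod_def atLeast0LessThan)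
  also have "\<dots> = (\<Sum>k<m. if k = i then D $$ (i, i) * A $$ (i, j) else 0)"
    using assms by (intro sum.cong) (auto simp: diagonal_mat_def)
  finally show ?thesis using assms by simp
qed

text \<open>\<open>A * D * B\<close> is the sum over \<open>k\<close> of column \<open>k\<close> of
  \<open>A\<close> times row \<open>k\<close> of \<open>B\<close>, weighted by the diagonal of
  \<open>D\<close>; only the first \<open>r\<close> weights can be nonzero.\<close>

lemma (in vec_space) rank_mult_diagonal_mat_mult_le:
  assumes "A \<in> carrier_mat n n" "D \<in> carrier_mat n n" "B \<in> carrier_mat n n" "diagonal_mat D"
    and "r \<le> n" and "\<And>i. r \<le> i \<Longrightarrow> i < n \<Longrightarrow> D $$ (i, i) = 0"
  shows "rank (A * D * B) \<le> r"
proof (rule rank_sum_products_le)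
  show "A * D * B \<in> carrier_mat n n" using assms by simp
  fix i j assume ij: "i < n" "j < n"
  have "(A * D * B) $$ (i, j) = (\<Sum>k<n. A $$ (i, k) * D $$ (k, k) * B $$ (k, j))"
    using assms(1-4) ij index_mult_diagonal_mat[OF assms(1,2,4)]
    by (subst index_mult_mat) (auto simp: scalar_prod_def atLeast0LessThan)
  also have "\<dots> = (\<Sum>k<r. A $$ (i, k) * D $$ (k, k) * B $$ (k, j))"
    using assms(5,6) by (intro sum.mono_neutral_right) auto
  finally show "(A * D * B) $$ (i, j) = (\<Sum>k<r. (A $$ (i, k) * D $$ (k, k)) * B $$ (k, j))" .
qed

section \<open>Integral matrices\<close>

context complete_discrete_valuation_field
begin

section \<open>Valuation and ring of integers\<close>

text \<open>Since \<open>range_val\<close> rules out \<open>Minf\<close>, questions about valuations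
  of nonzero elements become integer arithmetic.\<close>

lemma val_cases: obtains "x = 0" | k where "x \<noteq> 0" "val x = Fin k"
proof (cases "x = 0")
  case False
  have "val x \<in> range Fin \<union> {Pinf}" using range_val by auto
  then obtain k where "val x = Fin k" using False val_eq_Pinf_iff[of x] by auto
  then show thesis using False that(2) by simp
qed (use that in simp)

lemma val_zero [simp]: "val 0 = Pinf"
  by (simp add: val_eq_Pinf_iff)

lemma val_one [simp]: "val 1 = 0"
proof -
  obtain k where "val 1 = Fin k" by (rule val_cases[of 1]) auto
  then show ?thesis using val_mult[of 1 1] by (simp add: zero_extended_def)
qed

lemma val_uminus [simp]: "val (- x) = val x"
proof -
  obtain k where k: "val (- 1) = Fin k" by (rule val_cases[of "- 1"]) auto
  \<comment> \<open>The square of -1 is 1, so twice this valuation is 0.\<close>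
  then have "val (- 1) = 0" using val_mult[of "- 1" "- 1"] by (simp add: zero_extended_def)
  then show ?thesis using val_mult[of "- 1" x] by simp
qed

lemma val_prod: "val (prod f A) = (\<Sum>i\<in>A. val (f i))"
  by (induction A rule: infinite_finite_induct) (simp_all add: val_mult)

lemma val_inverse: "x \<noteq> 0 \<Longrightarrow> val x = Fin k \<Longrightarrow> val (inverse x) = Fin (- k)"
  using val_mult[of x "inverse x"] 
  by (cases "inverse x" rule: val_cases) (auto simp: zero_extended_def)

text \<open>Integer exponents matter: \<open>M\<close> need not be integral, so the exponent in the
  theorem can be negative.\<close>

lemma val_powi:
  assumes "val x = 1"
  shows "val (x powi k) = Fin k"
proof -
  have nat: "val (x ^ j) = Fin (int j)" for j
    by (induction j) (simp_all add: val_mult assms zero_extended_def one_extended_def add.commute)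
  have "x \<noteq> 0" using assms by (auto simp: one_extended_def)
  then show ?thesis
    using val_inverse[OF _ nat[of "nat (- k)"]] nat[of "nat k"]
    by (cases "k \<ge> 0") (auto simp: power_int_def power_inverse)
qed

lemma integer_ring_zero [simp]: "0 \<in> integer_ring val"
  and integer_ring_one [simp]: "1 \<in> integer_ring val"
  by (simp_all add: integer_ring_def)

lemma integer_ring_add: "x \<in> integer_ring val \<Longrightarrow> y \<in> integer_ring val \<Longrightarrow> x + y \<in> integer_ring val"
  using val_add[of x y] by (auto simp: integer_ring_def min_def split: if_splits)

lemma integer_ring_mult: "x \<in> integer_ring val \<Longrightarrow> y \<in> integer_ring val \<Longrightarrow> x * y \<in> integer_ring val"
  by (cases x rule: val_cases; cases y rule: val_cases)
    (auto simp: integer_ring_def val_mult zero_extended_def)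

lemma integer_ring_uminus: "x \<in> integer_ring val \<Longrightarrow> - x \<in> integer_ring val"
  by (simp add: integer_ring_def)

lemma integer_ring_diff: "x \<in> integer_ring val \<Longrightarrow> y \<in> integer_ring val \<Longrightarrow> x - y \<in> integer_ring val"
  using integer_ring_add[of x "- y"] by (simp add: integer_ring_uminus)

lemma integer_ring_sum: "(\<And>i. i \<in> A \<Longrightarrow> f i \<in> integer_ring val) \<Longrightarrow> sum f A \<in> integer_ring val"
  by (induction A rule: infinite_finite_induct) (auto intro: integer_ring_add)

lemma integer_ring_prod: "(\<And>i. i \<in> A \<Longrightarrow> f i \<in> integer_ring val) \<Longrightarrow> prod f A \<in> integer_ring val"
  by (induction A rule: infinite_finite_induct) (auto intro: integer_ring_mult)

text \<open>The finite value \<open>val a\<close> can be cancelled from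
  \<open>val b = val (b / a) + val a\<close>. Divisibility over the ring of integers thus becomes a
  comparison of valuations.\<close>

lemma divide_mem_integer_ring_iff: "a \<noteq> 0 \<Longrightarrow> b / a \<in> integer_ring val \<longleftrightarrow> val a \<le> val b"
  using val_mult[of "b / a" a]
  by (cases a rule: val_cases; cases "b / a" rule: val_cases)
    (auto simp: integer_ring_def zero_extended_def)

lemma val_le_val_mult: "x \<in> integer_ring val \<Longrightarrow> val a \<le> val (a * x)"
  by (cases "a = 0") (simp_all flip: divide_mem_integer_ring_iff)

lemma val_mult_mono: "val x \<le> val y \<Longrightarrow> val (a * x) \<le> val (a * y)"
  by (simp add: val_mult add_left_mono)

section \<open>Matrices over the ring of integers and their units\<close>

lemma integral_matsD:
  "A \<in> integral_mats val n \<Longrightarrow> A \<in> carrier_mat n n"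
  "A \<in> integral_mats val n \<Longrightarrow> i < n \<Longrightarrow> j < n \<Longrightarrow> A $$ (i, j) \<in> integer_ring val"
  by (simp_all add: integral_mats_def)

lemma integral_mats_one [simp]: "1\<^sub>m n \<in> integral_mats val n"
  by (simp add: integral_mats_def)

lemma integral_mats_mult:
  assumes "A \<in> integral_mats val n" "B \<in> integral_mats val n"
  shows "A * B \<in> integral_mats val n"
  using assms
  by (auto simp: integral_mats_def scalar_prod_def intro!: integer_ring_sum integer_ring_mult)

text \<open>The Leibniz formula expresses the determinant by sums, products and signs of
  entries.\<close>

lemma det_mem_integer_ring:
  assumes "A \<in> integral_mats val n"
  shows "det A \<in> integer_ring val"
proof -
  have "signof p * (\<Prod>i = 0..<n. A $$ (i, p i)) \<in> integer_ring val" if "p permutes {0..<n}" for p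
    using integral_matsD(2)[OF assms] permutes_in_image[OF that]
    by (cases p rule: sign_cases)
      (auto intro!: integer_ring_prod integer_ring_uminus)
  then show ?thesis
    unfolding det_def'[OF integral_matsD(1)[OF assms]] by (auto intro: integer_ring_sum)
qed

lemma adj_mat_integral:
  assumes "A \<in> integral_mats val n"
  shows "adj_mat A \<in> integral_mats val n"
proof -
  have A: "A \<in> carrier_mat n n" using assms by (rule integral_matsD)
  have "mat_delete A i j \<in> integral_mats val (n - 1)" if "i < n" "j < n" for i j
    using assms that by (auto simp: integral_mats_def mat_delete_def)
  then have "cofactor A i j \<in> integer_ring val" if "i < n" "j < n" for i j
    using det_mem_integer_ring[of "mat_delete A i j" "n - 1"] that
    by (simp add: cofactor_def minus_one_power_iff integer_ring_uminus)
  then show ?thesis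
    using A by (auto simp: integral_mats_def adj_mat_def)
qed

lemma integral_GL_I:
  "U \<in> integral_mats val n \<Longrightarrow> W \<in> integral_mats val n \<Longrightarrow> U * W = 1\<^sub>m n \<Longrightarrow> W * U = 1\<^sub>m n \<Longrightarrow>
    U \<in> integral_GL val n"
  by (auto simp: integral_GL_def)

lemma integral_GL_E:
  assumes "U \<in> integral_GL val n"
  obtains W where "U \<in> carrier_mat n n" "W \<in> carrier_mat n n"
    "U \<in> integral_mats val n" "W \<in> integral_mats val n" "U * W = 1\<^sub>m n" "W * U = 1\<^sub>m n"
  using assms by (auto simp: integral_GL_def integral_mats_def)

lemma integral_GL_carrier: "U \<in> integral_GL val n \<Longrightarrow> U \<in> carrier_mat n n"
  by (auto elim: integral_GL_E)

lemma integral_GL_one [simp]: "1\<^sub>m n \<in> integral_GL val n"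
  by (rule integral_GL_I[of _ _ "1\<^sub>m n"]) auto

lemma integral_GL_mult:
  assumes "A \<in> integral_GL val n" "B \<in> integral_GL val n"
  shows "A * B \<in> integral_GL val n"
proof -
  obtain A' where A: "A \<in> carrier_mat n n" "A' \<in> carrier_mat n n"
    "A \<in> integral_mats val n" "A' \<in> integral_mats val n" "A * A' = 1\<^sub>m n" "A' * A = 1\<^sub>m n"
    using assms(1) by (rule integral_GL_E)
  obtain B' where B: "B \<in> carrier_mat n n" "B' \<in> carrier_mat n n"
    "B \<in> integral_mats val n" "B' \<in> integral_mats val n" "B * B' = 1\<^sub>m n" "B' * B = 1\<^sub>m n"
    using assms(2) by (rule integral_GL_E)
  have "A * B * (B' * A') = A * (B * B') * A'"
    using A(1,2) B(1,2) by (simp add: assoc_mult_mat[of _ n n _ n _ n])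
  moreover have "B' * A' * (A * B) = B' * (A' * A) * B"
    using A(1,2) B(1,2) by (simp add: assoc_mult_mat[of _ n n _ n _ n])
  ultimately show ?thesis
    using A B by (intro integral_GL_I[of _ _ "B' * A'"] integral_mats_mult) simp_all
qed

text \<open>If \<open>W\<close> is the inverse of \<open>U\<close>, then anti-multiplicativity makes
  \<open>adj_mat W\<close> the inverse of \<open>adj_mat U\<close>, and both are integral.\<close>

lemma adj_mat_integral_GL:
  assumes "U \<in> integral_GL val n"
  shows "adj_mat U \<in> integral_GL val n"
proof -
  obtain W where "U \<in> carrier_mat n n" "W \<in> carrier_mat n n"
    "U \<in> integral_mats val n" "W \<in> integral_mats val n" "U * W = 1\<^sub>m n" "W * U = 1\<^sub>m n"
    using assms by (rule integral_GL_E)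
  then show ?thesis
    by (intro integral_GL_I[of _ _ "adj_mat W"] adj_mat_integral)
      (simp_all add: adj_mat_one flip: adj_mat_mult[of _ n])
qed

text \<open>The substitution is invertible on the lattice: the preimage of \<open>X\<close> is
  \<open>A' * X * B'\<close> with the integral inverses \<open>A'\<close> and
  \<open>B'\<close>.\<close>

lemma image_mult_integral_mats:
  assumes "A \<in> integral_GL val n" "B \<in> integral_GL val n"
  shows "(\<lambda>X. A * X * B) ` integral_mats val n = integral_mats val n"
proof (intro equalityI subsetI)
  obtain A' where A: "A \<in> carrier_mat n n" "A' \<in> carrier_mat n n"
    "A \<in> integral_mats val n" "A' \<in> integral_mats val n" "A * A' = 1\<^sub>m n" "A' * A = 1\<^sub>m n"
    using assms(1) by (rule integral_GL_E)
  obtain B' where B: "B \<in> carrier_mat n n" "B' \<in> carrier_mat n n"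
    "B \<in> integral_mats val n" "B' \<in> integral_mats val n" "B * B' = 1\<^sub>m n" "B' * B = 1\<^sub>m n"
    using assms(2) by (rule integral_GL_E)
  fix X
  show "X \<in> integral_mats val n" if "X \<in> (\<lambda>X. A * X * B) ` integral_mats val n"
    using that A B by (auto intro!: integral_mats_mult)
  assume X: "X \<in> integral_mats val n"
  note Xc = integral_matsD(1)[OF X]
  have "A * (A' * X * B') * B = A * A' * X * (B' * B)"
    using A(1,2) B(1,2) Xc by (simp add: assoc_mult_mat[of _ n n _ n _ n])
  then have "X = A * (A' * X * B') * B" using A(5) B(6) Xc by simp
  moreover have "A' * X * B' \<in> integral_mats val n" using A B X by (auto intro!: integral_mats_mult)
  ultimately show "X \<in> (\<lambda>X. A * X * B) ` integral_mats val n" by blast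
qed

section \<open>Existence of the Smith decomposition\<close>

lemma is_smith_decomposition_iff:
  "M \<in> carrier_mat n n \<Longrightarrow> is_smith_decomposition val M (U, D, V) \<longleftrightarrow>
    U \<in> integral_GL val n \<and> V \<in> integral_GL val n \<and> D \<in> carrier_mat n n \<and> diagonal_mat D \<and>
    (\<forall>i. Suc i < n \<longrightarrow> val (D $$ (i, i)) \<le> val (D $$ (Suc i, Suc i))) \<and> M = U * D * V"
  by (simp add: is_smith_decomposition_def Let_def)

text \<open>Units are absorbed into the outer factors while \<open>D\<close> stays the same, so
  integral row and column operations are harmless.\<close>

lemma is_smith_decomposition_mult:
  assumes M: "M \<in> carrier_mat n n" and A: "A \<in> integral_GL val n" and B: "B \<in> integral_GL val n"
    and smith: "is_smith_decomposition val M (U, D, V)"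
  shows "is_smith_decomposition val (A * M * B) (A * U, D, V * B)"
proof -
  have U: "U \<in> integral_GL val n" and V: "V \<in> integral_GL val n" and D: "D \<in> carrier_mat n n"
    and MUDV: "M = U * D * V"
    using smith by (simp_all add: is_smith_decomposition_iff[OF M])
  note carrier = integral_GL_carrier[OF A] integral_GL_carrier[OF B]
    integral_GL_carrier[OF U] integral_GL_carrier[OF V] D
  have AMB: "A * M * B \<in> carrier_mat n n" using carrier M by simp
  have "A * M * B = A * U * D * (V * B)"
    using carrier by (simp add: MUDV assoc_mult_mat[of _ n n _ n _ n])
  then show ?thesis
    using smith A B U V
    unfolding is_smith_decomposition_iff[OF M] is_smith_decomposition_iff[OF AMB]
    by (simp add: integral_GL_mult)
qed

section \<open>Integral block and permutation matrices for one elimination step\<close>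

lemma integral_mats_four_block:
  assumes "A \<in> carrier_mat 1 1" "B \<in> carrier_mat 1 m" "C \<in> carrier_mat m 1" "D \<in> integral_mats val m"
    and "A $$ (0, 0) \<in> integer_ring val" "\<And>j. j < m \<Longrightarrow> B $$ (0, j) \<in> integer_ring val"
    and "\<And>i. i < m \<Longrightarrow> C $$ (i, 0) \<in> integer_ring val"
  shows "four_block_mat A B C D \<in> integral_mats val (Suc m)"
  using assms by (auto simp: integral_mats_def)

lemma integral_GL_four_block_one:
  assumes "U \<in> integral_GL val m"
  shows "four_block_mat (1\<^sub>m 1) (0\<^sub>m 1 m) (0\<^sub>m m 1) U \<in> integral_GL val (Suc m)"
proof -
  obtain W where UW: "U \<in> carrier_mat m m" "W \<in> carrier_mat m m"
    "U \<in> integral_mats val m" "W \<in> integral_mats val m" "U * W = 1\<^sub>m m" "W * U = 1\<^sub>m m"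
    using assms by (rule integral_GL_E)
  then show ?thesis
    using four_block_one_mat[of 1 m]
    by (intro integral_GL_I[of _ _ "four_block_mat (1\<^sub>m 1) (0\<^sub>m 1 m) (0\<^sub>m m 1) W"] integral_mats_four_block)
      (auto simp: mult_four_block_mat[of _ 1 1 _ m _ m _ _ 1 _ m])
qed

lemma uminus_zero_mat: "- 0\<^sub>m n m = (0\<^sub>m n m :: 'b::group_add mat)"
  by (intro eq_matI) auto

text \<open>Negating the block \<open>c\<close> gives the inverse.\<close>

lemma integral_GL_lower:
  assumes c: "c \<in> carrier_mat m 1" and int: "\<And>i. i < m \<Longrightarrow> c $$ (i, 0) \<in> integer_ring val"
  shows "four_block_mat (1\<^sub>m 1) (0\<^sub>m 1 m) c (1\<^sub>m m) \<in> integral_GL val (Suc m)"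
proof -
  have "c + - c = 0\<^sub>m m 1" "- c + c = 0\<^sub>m m 1" using c by (auto intro!: eq_matI)
  then show ?thesis
    using assms four_block_one_mat[of 1 m]
    by (intro integral_GL_I[of _ _ "four_block_mat (1\<^sub>m 1) (0\<^sub>m 1 m) (- c) (1\<^sub>m m)"] integral_mats_four_block)
      (auto simp: mult_four_block_mat[of _ 1 1 _ m _ m _ _ 1 _ m] integer_ring_uminus uminus_zero_mat)
qed

lemma integral_GL_upper:
  assumes r: "r \<in> carrier_mat 1 m" and int: "\<And>j. j < m \<Longrightarrow> r $$ (0, j) \<in> integer_ring val"
  shows "four_block_mat (1\<^sub>m 1) r (0\<^sub>m m 1) (1\<^sub>m m) \<in> integral_GL val (Suc m)"
proof -
  have "r + - r = 0\<^sub>m 1 m" "- r + r = 0\<^sub>m 1 m" using r by (auto intro!: eq_matI)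
  then show ?thesis
    using assms four_block_one_mat[of 1 m]
    by (intro integral_GL_I[of _ _ "four_block_mat (1\<^sub>m 1) (- r) (0\<^sub>m m 1) (1\<^sub>m m)"] integral_mats_four_block)
      (auto simp: mult_four_block_mat[of _ 1 1 _ m _ m _ _ 1 _ m] integer_ring_uminus uminus_zero_mat)
qed

lemma swaprows_mat_integral_GL:
  assumes "k < n" "l < n"
  shows "swaprows_mat n k l \<in> integral_GL val n"
  by (rule integral_GL_I[of _ _ "swaprows_mat n k l"])
    (use assms in \<open>auto simp: integral_mats_def swaprows_mat_inv\<close>)

text \<open>One step of Gaussian elimination. Because the pivot \<open>a\<close> divides every
  entry, the row and column operations are integral, and \<open>a\<close> can also be factored out
  of the remaining block.\<close>

lemma clear_pivot:
  assumes M: "M \<in> carrier_mat (Suc m) (Suc m)" and a: "M $$ (0, 0) = a" "a \<noteq> 0"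
    and int: "\<And>i j. i \<le> m \<Longrightarrow> j \<le> m \<Longrightarrow> M $$ (i, j) / a \<in> integer_ring val"
  obtains L R B where "L \<in> integral_GL val (Suc m)" "R \<in> integral_GL val (Suc m)"
    "B \<in> integral_mats val m"
    "M = L * four_block_mat (a \<cdot>\<^sub>m 1\<^sub>m 1) (0\<^sub>m 1 m) (0\<^sub>m m 1) (a \<cdot>\<^sub>m B) * R"
proof -
  define c where "c = mat m 1 (\<lambda>(i, j). M $$ (Suc i, 0) / a)"
  define r where "r = mat 1 m (\<lambda>(i, j). M $$ (0, Suc j) / a)"
  \<comment> \<open>This is the Schur complement of the pivot, divided by \<open>a\<close>.\<close>
  define B where "B = mat m m (\<lambda>(i, j). M $$ (Suc i, Suc j) / a - M $$ (Suc i, 0) / a * (M $$ (0, Suc j) / a))"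
  have carrier: "c \<in> carrier_mat m 1" "r \<in> carrier_mat 1 m" "B \<in> carrier_mat m m"
    by (simp_all add: c_def r_def B_def)
  define L where "L = four_block_mat (1\<^sub>m 1) (0\<^sub>m 1 m) c (1\<^sub>m m)"
  define R where "R = four_block_mat (1\<^sub>m 1) r (0\<^sub>m m 1) (1\<^sub>m m)"
  have "L * four_block_mat (a \<cdot>\<^sub>m 1\<^sub>m 1) (0\<^sub>m 1 m) (0\<^sub>m m 1) (a \<cdot>\<^sub>m B)
      = four_block_mat (a \<cdot>\<^sub>m 1\<^sub>m 1) (0\<^sub>m 1 m) (a \<cdot>\<^sub>m c) (a \<cdot>\<^sub>m B)"
    unfolding L_def using carrier
    by (subst mult_four_block_mat[of _ 1 1 _ m _ m _ _ 1 _ m])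
      (auto simp: mult_smult_distrib[of _ m 1 _ 1] intro!: cong_four_block_mat)
  also have "\<dots> * R = four_block_mat (a \<cdot>\<^sub>m 1\<^sub>m 1) (a \<cdot>\<^sub>m r) (a \<cdot>\<^sub>m c) (a \<cdot>\<^sub>m (c * r) + a \<cdot>\<^sub>m B)"
    unfolding R_def using carrier
    by (subst mult_four_block_mat[of _ 1 1 _ m _ m _ _ 1 _ m])
      (auto simp: mult_smult_assoc_mat[of _ m 1 _ m] mult_smult_assoc_mat[of _ 1 1 _ m]
        mult_smult_assoc_mat[of _ m 1 _ 1] intro!: cong_four_block_mat)
  also have "\<dots> = M"
  proof (rule eq_matI)
    fix i j assume "i < dim_row M" "j < dim_col M"
    then show "four_block_mat (a \<cdot>\<^sub>m 1\<^sub>m 1) (a \<cdot>\<^sub>m r) (a \<cdot>\<^sub>m c) (a \<cdot>\<^sub>m (c * r) + a \<cdot>\<^sub>m B) $$ (i, j) = M $$ (i, j)"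
      using M a by (cases i; cases j) (auto simp: c_def r_def B_def scalar_prod_def field_simps)
  qed (use M carrier in auto)
  finally have "M = L * four_block_mat (a \<cdot>\<^sub>m 1\<^sub>m 1) (0\<^sub>m 1 m) (0\<^sub>m m 1) (a \<cdot>\<^sub>m B) * R" ..
  moreover have "L \<in> integral_GL val (Suc m)"
    unfolding L_def by (rule integral_GL_lower) (auto simp: c_def int)
  moreover have "R \<in> integral_GL val (Suc m)"
    unfolding R_def by (rule integral_GL_upper) (auto simp: r_def int)
  moreover have "B \<in> integral_mats val m"
    \<comment> \<open>The quotients must not be merged: integrality is known for each quotient by
      \<open>a\<close> separately.\<close>
    by (auto simp: integral_mats_def B_def simp del: times_divide_times_eq times_divide_eq_left
        times_divide_eq_right intro!: integer_ring_diff integer_ring_mult int)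
  ultimately show thesis using that by blast
qed

text \<open>The inductive step. The only new ordering condition compares \<open>a\<close> with the
  first diagonal entry of \<open>a\<close> times \<open>D\<close>; it holds because \<open>D\<close>
  is integral.\<close>

lemma is_smith_decomposition_four_block:
  assumes B: "B \<in> integral_mats val m" and smith: "is_smith_decomposition val B (U, D, V)"
  shows "is_smith_decomposition val
    (four_block_mat (a \<cdot>\<^sub>m 1\<^sub>m 1) (0\<^sub>m 1 m) (0\<^sub>m m 1) (a \<cdot>\<^sub>m B))
    (four_block_mat (1\<^sub>m 1) (0\<^sub>m 1 m) (0\<^sub>m m 1) U,
     four_block_mat (a \<cdot>\<^sub>m 1\<^sub>m 1) (0\<^sub>m 1 m) (0\<^sub>m m 1) (a \<cdot>\<^sub>m D),
     four_block_mat (1\<^sub>m 1) (0\<^sub>m 1 m) (0\<^sub>m m 1) V)"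
    (is "is_smith_decomposition val ?B (?U, ?D, ?V)")
proof -
  have U: "U \<in> integral_GL val m" and V: "V \<in> integral_GL val m" and D: "D \<in> carrier_mat m m"
    and diag: "diagonal_mat D" and BUDV: "B = U * D * V"
    and mono: "\<And>i. Suc i < m \<Longrightarrow> val (D $$ (i, i)) \<le> val (D $$ (Suc i, Suc i))"
    using smith by (simp_all add: is_smith_decomposition_iff[OF integral_matsD(1)[OF B]])
  note Uc = integral_GL_carrier[OF U] and Vc = integral_GL_carrier[OF V]
  obtain U' where U': "U' \<in> carrier_mat m m" "U' \<in> integral_mats val m" "U' * U = 1\<^sub>m m"
    using U by (rule integral_GL_E)
  obtain V' where V': "V' \<in> carrier_mat m m" "V' \<in> integral_mats val m" "V * V' = 1\<^sub>m m"
    using V by (rule integral_GL_E)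
  \<comment> \<open>Solving \<open>B = U * D * V\<close> for \<open>D\<close> shows that
    \<open>D\<close> inherits integrality from \<open>B\<close>.\<close>
  have "U' * B * V' = (U' * U) * D * (V * V')"
    using Uc Vc U'(1) V'(1) D by (simp add: BUDV assoc_mult_mat[of _ m m _ m _ m])
  then have "D = U' * B * V'" using D by (simp add: U' V')
  then have D_int: "D \<in> integral_mats val m" using U' V' B by (auto intro: integral_mats_mult)
  have "?U * ?D * ?V = ?B"
    using Uc Vc D
    by (simp add: BUDV mult_four_block_mat[of _ 1 1 _ m _ m _ _ 1 _ m]
        mult_smult_distrib[of _ m m _ m] mult_smult_assoc_mat[of _ m m _ m])
  moreover have "diagonal_mat ?D"
    using diag D by (auto simp: diagonal_mat_def)
  moreover have "val (?D $$ (i, i)) \<le> val (?D $$ (Suc i, Suc i))" if "Suc i < Suc m" for i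
  proof (cases i)
    case 0
    then show ?thesis
      using that D integral_matsD(2)[OF D_int, of 0 0] by (simp add: val_le_val_mult)
  next
    case (Suc k)
    then show ?thesis using that D mono[of k] by (simp add: val_mult_mono)
  qed
  moreover have "?B \<in> carrier_mat (Suc m) (Suc m)" "?D \<in> carrier_mat (Suc m) (Suc m)"
    using integral_matsD(1)[OF B] D by auto
  ultimately show ?thesis
    using integral_GL_four_block_one[OF U] integral_GL_four_block_one[OF V]
    by (simp add: is_smith_decomposition_iff)
qed

text \<open>Induction on the size: an entry of least valuation is moved to the corner, its row and
  column are cleared, and the remaining block is decomposed. Existence is what gives meaning to the
  choice in \<open>smith_decomposition\<close>, hence to \<open>sigma\<close>.\<close>

lemma smith_decomposition_exists:
  assumes "M \<in> carrier_mat n n"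
  shows "\<exists>T. is_smith_decomposition val M T"
  using assms
proof (induction n arbitrary: M)
  case 0
  then have "is_smith_decomposition val M (1\<^sub>m 0, M, 1\<^sub>m 0)"
    by (auto simp: is_smith_decomposition_iff diagonal_mat_def intro: eq_matI)
  then show ?case ..
next
  case (Suc m)
  let ?n = "Suc m"
  let ?S = "{..<?n} \<times> {..<?n}"
  show ?case
  proof (cases "M = 0\<^sub>m ?n ?n")
    case True
    then have "is_smith_decomposition val M (1\<^sub>m ?n, M, 1\<^sub>m ?n)"
      by (auto simp: is_smith_decomposition_iff[of _ ?n] diagonal_mat_def)
    then show ?thesis ..
  next
    case False
    have "\<exists>s. is_arg_min (\<lambda>x. val (M $$ x)) (\<lambda>x. x \<in> ?S) s"
      by (rule ex_is_arg_min_if_finite) auto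
    then obtain s where s: "s \<in> ?S" "\<And>x. x \<in> ?S \<Longrightarrow> val (M $$ s) \<le> val (M $$ x)"
      unfolding is_arg_min_linorder by blast
    obtain p q where pq: "s = (p, q)" "p < ?n" "q < ?n" using s(1) by auto
    define a where "a = M $$ (p, q)"
    have le: "val a \<le> val (M $$ (i, j))" if "i < ?n" "j < ?n" for i j
      using s(2)[of "(i, j)"] that by (simp add: a_def pq)
    have "a \<noteq> 0"
    proof
      assume "a = 0"
      then have "M $$ (i, j) = 0" if "i < ?n" "j < ?n" for i j
        using le[OF that] by (simp add: val_eq_Pinf_iff)
      then have "M = 0\<^sub>m ?n ?n" using Suc.prems by (intro eq_matI) auto
      then show False using False by simp
    qed
    \<comment> \<open>\<open>P\<close> swaps rows from the left and \<open>Q\<close> swaps columns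
      from the right, bringing \<open>a\<close> to position \<open>(0, 0)\<close>.\<close>
    define P Q :: "'a mat" where "P = swaprows_mat ?n 0 p" and "Q = swaprows_mat ?n 0 q"
    have P: "P \<in> integral_GL val ?n" and Q: "Q \<in> integral_GL val ?n"
      using pq by (simp_all add: P_def Q_def swaprows_mat_integral_GL)
    note carrier = integral_GL_carrier[OF P] integral_GL_carrier[OF Q] Suc.prems
    define N where "N = P * M * Q"
    have "N = swapcols 0 q (swaprows 0 p M)"
      using pq Suc.prems
      unfolding N_def P_def Q_def
      by (simp flip: swaprows_mat add: swapcols_mat[of _ ?n ?n])
    then have N_index: "N $$ (i, j) = M $$ (if i = 0 then p else if i = p then 0 else i,
        if j = 0 then q else if j = q then 0 else j)" if "i < ?n" "j < ?n" for i j
      using that pq Suc.prems by auto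
    have N: "N \<in> carrier_mat ?n ?n" using carrier by (simp add: N_def)
    \<comment> \<open>Swaps are involutions, so \<open>M\<close> is recovered from \<open>N\<close>
      by the same matrices.\<close>
    have "M = (P * P) * M * (Q * Q)"
      using pq Suc.prems by (simp add: P_def Q_def swaprows_mat_inv)
    then have M: "M = P * N * Q"
      using carrier by (simp add: N_def assoc_mult_mat[of _ ?n ?n _ ?n _ ?n])
    have "N $$ (i, j) / a \<in> integer_ring val" if "i \<le> m" "j \<le> m" for i j
      using that pq le by (simp add: N_index divide_mem_integer_ring_iff \<open>a \<noteq> 0\<close>)
    moreover have "N $$ (0, 0) = a" by (simp add: N_index a_def)
    ultimately obtain L R B where LRB: "L \<in> integral_GL val ?n" "R \<in> integral_GL val ?n"
      "B \<in> integral_mats val m"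
      "N = L * four_block_mat (a \<cdot>\<^sub>m 1\<^sub>m 1) (0\<^sub>m 1 m) (0\<^sub>m m 1) (a \<cdot>\<^sub>m B) * R"
      using clear_pivot[OF N _ \<open>a \<noteq> 0\<close>] by blast
    obtain U D V where "is_smith_decomposition val B (U, D, V)"
      using Suc.IH[OF integral_matsD(1)[OF LRB(3)]] by auto
    note block = is_smith_decomposition_four_block[OF LRB(3) this, of a]
    have "four_block_mat (a \<cdot>\<^sub>m 1\<^sub>m 1) (0\<^sub>m 1 m) (0\<^sub>m m 1) (a \<cdot>\<^sub>m B) \<in> carrier_mat ?n ?n"
      using integral_matsD(1)[OF LRB(3)] by auto
    \<comment> \<open>The inner application passes from the block matrix to \<open>N\<close>, the
      outer one from \<open>N\<close> to \<open>M\<close>.\<close>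
    from is_smith_decomposition_mult[OF N P Q is_smith_decomposition_mult[OF this LRB(1,2) block, folded LRB(4)]]
    show ?thesis unfolding M by (rule exI)
  qed
qed

section \<open>The differential of the determinant at a diagonal matrix\<close>

lemma diagonal_val_mono:
  assumes "\<forall>i. Suc i < n \<longrightarrow> val (D $$ (i, i)) \<le> val (D $$ (Suc i, Suc i))" "i \<le> j" "j < n"
  shows "val (D $$ (i, i)) \<le> val (D $$ (j, j))"
  using assms(2,3)
proof (induction j rule: dec_induct)
  case (step k)
  then show ?case using assms(1) by (meson Suc_lessD order_trans)
qed simp

text \<open>Compare entries in \<open>D * adj_mat D\<close> and \<open>adj_mat D * D\<close>, both
  equal to \<open>det D\<close> times the identity, and cancel a nonzero diagonal entry of
  \<open>D\<close>. The last entry of \<open>D\<close> may vanish, so the last entry of the adjugate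
  is computed as a minor instead.\<close>

lemma adj_mat_diagonal:
  fixes D :: "'a mat" and m :: nat
  assumes D: "D \<in> carrier_mat (Suc m) (Suc m)" "diagonal_mat D"
    and nz: "\<And>i. i < m \<Longrightarrow> D $$ (i, i) \<noteq> 0"
  defines "p \<equiv> \<Prod>i<m. D $$ (i, i)"
  shows "diagonal_mat (adj_mat D)"
    and "i < m \<Longrightarrow> adj_mat D $$ (i, i) = p * (D $$ (m, m) / D $$ (i, i))"
    and "adj_mat D $$ (m, m) = p"
proof -
  let ?n = "Suc m"
  note adj = adj_mat[OF D(1)]
  have left: "D $$ (i, i) * adj_mat D $$ (i, j) = (if i = j then det D else 0)"
    if "i < ?n" "j < ?n" for i j
    using that D adj(1) by (simp flip: index_diagonal_mat_mult add: adj(2))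
  have right: "adj_mat D $$ (i, j) * D $$ (j, j) = (if i = j then det D else 0)"
    if "i < ?n" "j < ?n" for i j
    using that D adj(1) by (simp flip: index_mult_diagonal_mat add: adj(3))
  show "diagonal_mat (adj_mat D)"
    unfolding diagonal_mat_def
  proof (intro allI impI)
    fix i j assume "i < dim_row (adj_mat D)" "j < dim_col (adj_mat D)" "i \<noteq> j"
    \<comment> \<open>Distinct indices cannot both be \<open>m\<close>, so on one side the factor
      from \<open>D\<close> is nonzero.\<close>
    then have ij: "i < ?n" "j < ?n" "i < m \<or> j < m" using adj(1) by auto
    then show "adj_mat D $$ (i, j) = 0"
      using left[OF ij(1,2)] right[OF ij(1,2)] nz \<open>i \<noteq> j\<close> by auto
  qed
  have "det D = prod_list (diag_mat D)"
    using D by (intro det_upper_triangular[of _ ?n]) (auto simp: diagonal_mat_def)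
  also have "\<dots> = p * D $$ (m, m)"
    using D(1) by (simp add: prod_list_diag_prod p_def atLeast0LessThan)
  finally have det: "det D = p * D $$ (m, m)" .
  show "adj_mat D $$ (i, i) = p * (D $$ (m, m) / D $$ (i, i))" if "i < m"
    using left[of i i] nz[OF that] that by (simp add: det field_simps)
  have delete: "mat_delete D m m = mat m m (\<lambda>(i, j). D $$ (i, j))"
    using D(1) by (intro eq_matI) (auto simp: mat_delete_def)
  have "adj_mat D $$ (m, m) = det (mat_delete D m m)"
    using D(1) by (simp add: adj_mat_def cofactor_def)
  also have "\<dots> = prod_list (diag_mat (mat_delete D m m))"
    using D by (intro det_upper_triangular[of _ m]) (auto simp: delete diagonal_mat_def)
  also have "\<dots> = p"
    by (simp add: prod_list_diag_prod p_def atLeast0LessThan delete)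
  finally show "adj_mat D $$ (m, m) = p" .
qed

text \<open>After the product of the first \<open>m\<close> diagonal entries is factored out, a
  linear form in the diagonal of \<open>X\<close> remains. Its coefficients are integral by the
  ordering, and the last one is 1, so it maps the integral matrices onto the ring of
  integers.\<close>

lemma det_differential_diagonal_image:
  assumes D: "D \<in> carrier_mat (Suc m) (Suc m)" "diagonal_mat D"
    and mono: "\<forall>i. Suc i < Suc m \<longrightarrow> val (D $$ (i, i)) \<le> val (D $$ (Suc i, Suc i))"
    and nz: "\<And>i. i < m \<Longrightarrow> D $$ (i, i) \<noteq> 0"
  shows "det_differential D ` integral_mats val (Suc m) =
    {(\<Prod>i<m. D $$ (i, i)) * x | x. x \<in> integer_ring val}"
proof -
  let ?n = "Suc m"
  define p where "p = (\<Prod>i<m. D $$ (i, i))"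
  note adjD = adj_mat_diagonal[OF D nz, folded p_def] adj_mat(1)[OF D(1)]
  have diff: "det_differential D X = p * ((\<Sum>i<m. D $$ (m, m) / D $$ (i, i) * X $$ (i, i)) + X $$ (m, m))"
    if X: "X \<in> carrier_mat ?n ?n" for X
  proof -
    have "det_differential D X = (\<Sum>i<?n. adj_mat D $$ (i, i) * X $$ (i, i))"
      unfolding det_differential_def mat_trace_def
      using X adjD(1,4) by (intro sum.cong) (auto simp: index_diagonal_mat_mult[of _ ?n _ ?n] simp del: index_mult_mat(1))
    also have "\<dots> = (\<Sum>i<m. p * (D $$ (m, m) / D $$ (i, i)) * X $$ (i, i)) + p * X $$ (m, m)"
      by (simp add: adjD)
    finally show ?thesis by (simp add: distrib_left sum_distrib_left mult.assoc)
  qed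
  have "D $$ (m, m) / D $$ (i, i) \<in> integer_ring val" if "i < m" for i
    using diagonal_val_mono[OF mono, of i m] nz[OF that] that by (simp add: divide_mem_integer_ring_iff)
  then have "(\<Sum>i<m. D $$ (m, m) / D $$ (i, i) * X $$ (i, i)) + X $$ (m, m) \<in> integer_ring val"
    if "X \<in> integral_mats val ?n" for X
    using integral_matsD(2)[OF that]
    by (intro integer_ring_add integer_ring_sum integer_ring_mult) auto
  moreover have "\<exists>X \<in> integral_mats val ?n. det_differential D X = p * x"
    if x: "x \<in> integer_ring val" for x
  proof
    \<comment> \<open>Only the coefficient 1 at position \<open>(m, m)\<close> is used to reach
      \<open>x\<close>.\<close>
    let ?X = "mat ?n ?n (\<lambda>(i, j). if i = m \<and> j = m then x else 0)"
    show "?X \<in> integral_mats val ?n" using x by (simp add: integral_mats_def)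
    show "det_differential D ?X = p * x" by (simp add: diff)
  qed
  ultimately show ?thesis
    unfolding p_def[symmetric] by (force simp: diff[OF integral_matsD(1)] image_iff)
qed

text \<open>Elements of equal valuation divide each other in the ring of integers, or both vanish.
  This lets a power of the uniformizer replace a product of diagonal entries.\<close>

lemma multiples_eq_of_val_eq:
  assumes "val a = val b"
  shows "{a * x | x. x \<in> integer_ring val} = {b * x | x. x \<in> integer_ring val}"
proof -
  have "{a * x | x. x \<in> integer_ring val} \<subseteq> {b * x | x. x \<in> integer_ring val}"
    if "val a = val b" for a b
  proof (cases "b = 0")
    case True
    then show ?thesis using that val_eq_Pinf_iff[of a] by auto
  next
    case False
    then have "a / b \<in> integer_ring val" using that by (simp add: divide_mem_integer_ring_iff)
    then have "\<exists>y. a * x = b * y \<and> y \<in> integer_ring val" if "x \<in> integer_ring val" for x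
      using False that by (intro exI[of _ "a / b * x"]) (simp add: integer_ring_mult del: times_divide_eq_left)
    then show ?thesis by auto
  qed
  then show ?thesis using assms by (intro equalityI) auto
qed

end

theorem proposition3p2:
  fixes val :: "'a::field \<Rightarrow> int extended" and \<pi> :: 'a and n :: nat and M :: "'a mat"
  assumes "complete_discrete_valuation_field val"
    and "val \<pi> = 1"
    and "n \<ge> 1"
    and "M \<in> carrier_mat n n"
    and "vec_space.rank n M \<ge> n - 1"
  shows "\<exists>v::int. (\<Sum>i = 1..n - 1. sigma val M i) = Fin v \<and>
    det_differential M ` integral_mats val n = {\<pi> powi v * x | x. x \<in> integer_ring val}"
proof -
  interpret complete_discrete_valuation_field val by fact
  obtain m where n: "n = Suc m" using \<open>n \<ge> 1\<close> by (cases n) auto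
  interpret vec_space "TYPE('a)" n .
  note M = \<open>M \<in> carrier_mat n n\<close>
  obtain U D V where smith_eq: "smith_decomposition val M = (U, D, V)"
    by (cases "smith_decomposition val M") auto
  have "is_smith_decomposition val M (U, D, V)"
    using someI_ex[OF smith_decomposition_exists[OF M]] smith_eq by (simp add: smith_decomposition_def)
  then have U: "U \<in> integral_GL val n" and V: "V \<in> integral_GL val n"
    and D: "D \<in> carrier_mat n n" "diagonal_mat D"
    and mono: "\<forall>i. Suc i < n \<longrightarrow> val (D $$ (i, i)) \<le> val (D $$ (Suc i, Suc i))"
    and MUDV: "M = U * D * V"
    by (simp_all add: is_smith_decomposition_iff[OF M])
  note Uc = integral_GL_carrier[OF U] and Vc = integral_GL_carrier[OF V]
  \<comment> \<open>A zero at position \<open>k\<close> has the largest valuation, so the ordering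
    makes all later diagonal entries zero and the rank is at most \<open>k < n - 1\<close>.\<close>
  have nz: "D $$ (k, k) \<noteq> 0" if "k < m" for k
  proof
    assume "D $$ (k, k) = 0"
    then have "D $$ (i, i) = 0" if "k \<le> i" "i < n" for i
      using diagonal_val_mono[OF mono that] by (simp add: val_eq_Pinf_iff)
    then have "rank M \<le> k"
      unfolding MUDV using \<open>k < m\<close> by (intro rank_mult_diagonal_mat_mult_le Uc D Vc) (auto simp: n)
    then show False using assms(5) \<open>k < m\<close> by (simp add: n)
  qed
  define p where "p = (\<Prod>i<m. D $$ (i, i))"
  have "p \<noteq> 0" using nz by (simp add: p_def)
  then obtain v where v: "val p = Fin v" by (cases p rule: val_cases) auto
  have "(\<Sum>i = 1..n - 1. sigma val M i) = (\<Sum>i<m. val (D $$ (i, i)))"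
    \<comment> \<open>The shift by one matches \<open>sigma\<close>, indexed from 1, with the
      diagonal of \<open>D\<close>, indexed from 0.\<close>
    by (rule sum.reindex_bij_witness[of _ Suc "\<lambda>i. i - 1"]) (auto simp: n sigma_def smith_eq)
  also have "\<dots> = Fin v" by (simp add: v[symmetric] p_def val_prod)
  finally have sum: "(\<Sum>i = 1..n - 1. sigma val M i) = Fin v" .
  have "det_differential M ` integral_mats val n =
      (\<lambda>X. det_differential D (adj_mat U * X * adj_mat V)) ` integral_mats val n"
    unfolding MUDV
    by (intro image_cong refl det_differential_mult[OF Uc D(1) Vc] integral_matsD(1))
  also have "\<dots> = det_differential D ` ((\<lambda>X. adj_mat U * X * adj_mat V) ` integral_mats val n)"
    by (simp add: image_image)
  also have "\<dots> = det_differential D ` integral_mats val n"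
    by (simp add: image_mult_integral_mats adj_mat_integral_GL U V)
  also have "\<dots> = {p * x | x. x \<in> integer_ring val}"
    using det_differential_diagonal_image[of D m] D mono nz by (simp add: n p_def)
  also have "\<dots> = {\<pi> powi v * x | x. x \<in> integer_ring val}"
    by (rule multiples_eq_of_val_eq) (simp add: v val_powi assms(2))
  finally show ?thesis using sum by blast
qed

end
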